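(* For all $\theta,\theta'\in\mathrm{Sym}^+(2,\mathbb{R})$, the Kullback–Leibler divergence between the Poincaré distributions $p_\theta$ and $p_{\theta'}$ is $$D_{\mathrm{KL}}[p_\theta:p_{\theta'}]=\frac12\log\frac{|\theta|}{|\theta'|}+2\left(\sqrt{|\theta|}-\sqrt{|\theta'|}\right)+\left(\frac12+\sqrt{|\theta|}\right)\left(\mathrm{tr}(\theta'\theta^{-1})-2\right).$$
   Context: $\mathbb{H}=\{(x,y)\in\mathbb{R}^2: y>0\}$. $\mathrm{Sym}^+(2,\mathbb{R})$ is the set of real symmetric positive-definite $2\times2$ matrices; $|\cdot|$ denotes the determinant of a matrix. For $\theta=\begin{bmatrix} a & b \\ b & c \end{bmatrix}\in\mathrm{Sym}^+(2,\mathbb{R})$, the Poincaré distribution $p_\theta$ is the probability distribution on $\mathbb{H}$ with density (with respect to $dx\,dy$) $$p_\theta(x,y)=\frac{\sqrt{|\theta|}\,e^{2\sqrt{|\theta|}}}{\pi}\exp\left(-\frac{a(x^2+y^2)+2bx+c}{y}\right)\frac1{y^2}.$$ $D_{\mathrm{KL}}[p:q]=\int_{\mathbb{H}}p\log\frac{p}{q}\,dx\,dy$. *)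

theory Defs
  imports "HOL-Probability.Probability"
begin

definition upper_half_plane :: "(real \<times> real) set" where
  "upper_half_plane = {(x, y). y > 0}"

definition sym_pos_def :: "(real^2^2) set" where
  "sym_pos_def = {A. transpose A = A \<and> (\<forall>v. v \<noteq> 0 \<longrightarrow> v \<bullet> (A *v v) > 0)}"

definition poincare_density :: "real^2^2 \<Rightarrow> real \<times> real \<Rightarrow> real" where
  "poincare_density \<theta> = (\<lambda>(x, y).
     sqrt (det \<theta>) * exp (2 * sqrt (det \<theta>)) / pi *
     exp (- ((\<theta>$1$1 * (x\<^sup>2 + y\<^sup>2) + 2 * \<theta>$1$2 * x + \<theta>$2$2) / y)) * (1 / y\<^sup>2))"

definition poincare_distribution :: "real^2^2 \<Rightarrow> (real \<times> real) measure" where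
  "poincare_distribution \<theta> =
     density (restrict_space lborel upper_half_plane) (\<lambda>z. ennreal (poincare_density \<theta> z))"

(* The argument order of KL_divergence is reversed: KL_divergence b Q P integrates with
   respect to P the logarithm to base b of the Radon-Nikodym derivative dP/dQ.
   KL_div_poincare_eq and integrable_entropy_density_poincare_iff below give the expression
   as the integral of p log (p / q) over the half-plane. *)
definition KL_div :: "'a measure \<Rightarrow> 'a measure \<Rightarrow> real" where
  "KL_div P Q = KL_divergence (exp 1) Q P"

lemma upper_half_plane_sets [measurable]: "upper_half_plane \<in> sets borel"
proof -
  have "upper_half_plane = {z. snd z > 0}" by (auto simp: upper_half_plane_def)
  moreover have "open {z::real\<times>real. snd z > 0}" by (intro open_Collect_less continuous_intros)
  ultimately show ?thesis by auto
qed

lemma poincare_density_measurable [measurable]: "poincare_density \<theta> \<in> borel_measurable borel"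
  unfolding poincare_density_def borel_prod[symmetric] by measurable

lemma sym_pos_def_det_pos:
  assumes "\<theta> \<in> sym_pos_def" shows "det \<theta> > 0"
proof -
  have s: "\<theta>$2$1 = \<theta>$1$2"
    using assms by (auto simp: sym_pos_def_def transpose_def vec_eq_iff)
  have p: "v \<bullet> (\<theta> *v v) > 0" if "v \<noteq> 0" for v
    using assms that by (auto simp: sym_pos_def_def)
  have a: "\<theta>$1$1 > 0"
    using p[of "vector [1, 0]"]
    by (auto simp: inner_vec_def sum_2 matrix_vector_mult_def vec_eq_iff forall_2)
  have "vector [- \<theta>$1$2, \<theta>$1$1] \<noteq> (0::real^2)"
    using a by (auto simp: vec_eq_iff forall_2)
  from p[OF this] have "0 < \<theta>$1$1 * det \<theta>"
    by (simp add: inner_vec_def sum_2 matrix_vector_mult_def det_2 s algebra_simps)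
  with a show ?thesis by (simp add: zero_less_mult_iff)
qed

lemma poincare_density_pos:
  assumes "\<theta> \<in> sym_pos_def" "z \<in> upper_half_plane"
  shows "poincare_density \<theta> z > 0"
  using assms sym_pos_def_det_pos[of \<theta>]
  by (auto simp: poincare_density_def upper_half_plane_def)

lemma sigma_finite_upper_half_plane:
  "sigma_finite_measure (restrict_space lborel upper_half_plane)"
  by (intro sigma_finite_measure_restrict_space sigma_finite_lborel) simp

lemma KL_div_poincare_eq:
  assumes "\<theta> \<in> sym_pos_def" "\<theta>' \<in> sym_pos_def"
  shows "KL_div (poincare_distribution \<theta>) (poincare_distribution \<theta>') =
    (LINT z:upper_half_plane|lborel.
       poincare_density \<theta> z * ln (poincare_density \<theta> z / poincare_density \<theta>' z))"
proof -
  interpret R: sigma_finite_measure "restrict_space lborel upper_half_plane"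
    by (rule sigma_finite_upper_half_plane)
  have m: "poincare_density t \<in> borel_measurable (restrict_space lborel upper_half_plane)" for t
    by (intro measurable_restrict_space1) simp
  have pos: "0 < poincare_density t z"
    if "t \<in> sym_pos_def" "z \<in> space (restrict_space lborel upper_half_plane)" for t z
    using that by (simp add: space_restrict_space poincare_density_pos)
  have "KL_div (poincare_distribution \<theta>) (poincare_distribution \<theta>') =
    (\<integral>z. poincare_density \<theta> z * log (exp 1) (poincare_density \<theta> z / poincare_density \<theta>' z)
       \<partial>restrict_space lborel upper_half_plane)"
    unfolding KL_div_def poincare_distribution_def
    using pos[OF assms(1)] pos[OF assms(2)]
    by (intro R.KL_density_density m AE_I2) (force intro: less_imp_le)+
  also have "\<dots> = (LINT z:upper_half_plane|lborel.
       poincare_density \<theta> z * ln (poincare_density \<theta> z / poincare_density \<theta>' z))"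
    by (simp add: integral_restrict_space set_lebesgue_integral_def log_def)
  finally show ?thesis .
qed

lemma integrable_entropy_density_poincare_iff:
  assumes "\<theta> \<in> sym_pos_def" "\<theta>' \<in> sym_pos_def"
  shows "integrable (poincare_distribution \<theta>)
      (entropy_density (exp 1) (poincare_distribution \<theta>') (poincare_distribution \<theta>)) \<longleftrightarrow>
    set_integrable lborel upper_half_plane
      (\<lambda>z. poincare_density \<theta> z * ln (poincare_density \<theta> z / poincare_density \<theta>' z))"
proof -
  define M where "M = restrict_space lborel upper_half_plane"
  define f where "f = poincare_density \<theta>'"
  define g where "g = poincare_density \<theta>"
  interpret R: sigma_finite_measure M
    unfolding M_def by (rule sigma_finite_upper_half_plane)
  have [measurable]: "f \<in> borel_measurable M" "g \<in> borel_measurable M"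
    unfolding M_def f_def g_def by (auto intro!: measurable_restrict_space1)
  have pos: "0 < f z" "0 < g z" if "z \<in> space M" for z
    using that assms by (auto simp: M_def f_def g_def space_restrict_space poincare_density_pos)
  have pos_AE: "AE z in M. 0 \<le> f z" "AE z in M. 0 \<le> g z" "AE z in M. f z = 0 \<longrightarrow> g z = 0"
    using pos by (force intro!: AE_I2)+
  interpret Mf: sigma_finite_measure "density M f"
    using pos_AE by (subst R.sigma_finite_iff_density_finite) auto
  have eq: "density (density M f) (\<lambda>z. ennreal (g z / f z)) = density M g"
    using pos_AE by (subst density_density_divide) simp_all
  have "AE z in density M f. ennreal (g z / f z) = RN_deriv (density M f) (density M g) z"
    by (rule Mf.RN_deriv_unique[OF _ eq]) measurable
  then have "AE z in M. ennreal (g z / f z) = RN_deriv (density M f) (density M g) z"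
    using pos by (subst (asm) AE_density) (auto elim!: AE_mp intro!: AE_I2)
  then have ed: "AE z in M. g z *\<^sub>R entropy_density (exp 1) (density M f) (density M g) z
      = g z * ln (g z / f z)"
  proof (rule AE_mp, intro AE_I2 impI)
    fix z assume "z \<in> space M"
      and e: "ennreal (g z / f z) = RN_deriv (density M f) (density M g) z"
    then have "0 \<le> g z / f z"
      using pos by (simp add: less_imp_le)
    then show "g z *\<^sub>R entropy_density (exp 1) (density M f) (density M g) z
        = g z * ln (g z / f z)"
      by (simp add: entropy_density_def log_def e[symmetric])
  qed
  have [measurable]: "entropy_density (exp 1) (density M f) (density M g) \<in> borel_measurable M"
    using measurable_entropy_density[of "exp 1" "density M f" "density M g"] by simp
  have "integrable (density M g) (entropy_density (exp 1) (density M f) (density M g)) \<longleftrightarrow>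
      integrable M (\<lambda>z. g z * ln (g z / f z))"
    by (subst integrable_density[OF _ _ pos_AE(2)], measurable)
      (rule integrable_cong_AE[OF _ _ ed], measurable)
  also have "\<dots> \<longleftrightarrow> set_integrable lborel upper_half_plane (\<lambda>z. g z * ln (g z / f z))"
    by (simp add: M_def integrable_restrict_space set_integrable_def)
  finally show ?thesis
    by (simp add: M_def f_def g_def poincare_distribution_def)
qed

end

(*
  Completing the square in x, with u = x + b/a, exhibits the Poincare density as a normal density
  in x of mean -b/a and variance y/(2a), times an inverse Gaussian density in y.  The logarithm of
  the density ratio is a linear combination of 1, 1/y, u/y, u^2/y and y, whose expectations
  follow from Fubini, the normal moments, and three inverse Gaussian integrals.
*)
theory Submission
  imports Defs "HOL-Real_Asymp.Real_Asymp"
begin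

section \<open>Gaussian primitive and integration on the half-line and the plane\<close>

text \<open>Near \<open>x\<close> the cdf is a constant plus an interval integral with fixed left
  endpoint \<open>x - 1\<close>, so the fundamental theorem of calculus applies. This is how a
  primitive of the Gaussian is obtained below.\<close>

lemma DERIV_cdf_density:
  fixes f :: "real \<Rightarrow> real"
  assumes cont: "continuous_on UNIV f" and int: "integrable lborel f" and nn: "\<And>x. 0 \<le> f x"
  shows "(cdf (density lborel f) has_real_derivative f x) (at x)"
proof -
  have [measurable]: "f \<in> borel_measurable borel" using int by auto
  have cdf_eq: "cdf (density lborel f) y = (LBINT t:{..y}. f t)" for y
    unfolding cdf_def2 measure_def
    by (subst emeasure_density) (auto simp: set_lebesgue_integral_def integral_eq_nn_integral nn
      nn_integral_set_ennreal mult.commute)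
  have si: "set_integrable lborel A f" if "A \<in> sets borel" for A
    using that int integrable_mult_indicator[of A lborel f] by (simp add: set_integrable_def)
  have split: "cdf (density lborel f) y = cdf (density lborel f) (x - 1) + (LBINT t=x-1..y. f t)"
    if "x - 1 \<le> y" for y
  proof -
    have "{..y} = {..x-1} \<union> {x-1<..y}" using that by auto
    then have "(LBINT t:{..y}. f t) = (LBINT t:{..x-1}. f t) + (LBINT t:{x-1<..y}. f t)"
      by (simp only:) (rule set_integral_Un, auto intro: si)
    then show ?thesis
      using that by (simp add: cdf_eq interval_integral_Ioc)
  qed
  \<comment> \<open>The window reaches 1 to either side of \<open>x\<close>, so \<open>x\<close> is
    an interior point and the derivative within the window is a two-sided derivative.\<close>
  have "((\<lambda>u. LBINT t=x-1..u. f t) has_vector_derivative f x) (at x within {x-1..x+1})"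
    by (rule interval_integral_FTC2) (auto intro: continuous_on_subset[OF cont])
  then have "((\<lambda>u. LBINT t=x-1..u. f t) has_real_derivative f x) (at x)"
    by (simp add: has_real_derivative_iff_has_vector_derivative at_within_Icc_at)
  then have "((\<lambda>u. cdf (density lborel f) (x - 1) + (LBINT t=x-1..u. f t)) has_real_derivative f x) (at x)"
    by (auto intro!: derivative_eq_intros)
  moreover have "\<forall>\<^sub>F y in nhds x. cdf (density lborel f) y = cdf (density lborel f) (x - 1) + (LBINT t=x-1..y. f t)"
    by (rule eventually_mono[OF eventually_nhds_in_open[of "{x-1<..}" x]]) (auto intro!: split)
  ultimately show ?thesis
    by (subst DERIV_cong_ev[OF refl _ refl])
qed

text \<open>The primitive is \<open>sqrt pi\<close> times the cdf of the normal law of variance 1/2,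
  whose density is \<open>exp (- x\<^sup>2) / sqrt pi\<close>. Both limits are then the limits of a
  cdf.\<close>

lemma gaussian_primitive:
  obtains G :: "real \<Rightarrow> real"
  where "\<And>x. (G has_real_derivative exp (- x\<^sup>2)) (at x)"
    and "(G \<longlongrightarrow> 0) at_bot" and "(G \<longlongrightarrow> sqrt pi) at_top"
proof -
  let ?f = "normal_density 0 (1 / sqrt 2)"
  interpret prob_space "density lborel ?f" by (rule prob_space_normal_density) simp
  interpret real_distribution "density lborel ?f" by unfold_locales auto
  have f_int: "integrable lborel ?f" by simp
  have f: "?f x * sqrt pi = exp (- x\<^sup>2)" for x
    by (simp add: normal_density_def power_divide real_sqrt_divide)
  have f_cont: "continuous_on UNIV ?f"
    unfolding normal_density_def[abs_def] by (intro continuous_intros) auto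
  have "(cdf (density lborel ?f) has_real_derivative ?f x) (at x)" for x
    by (rule DERIV_cdf_density) (use f_int f_cont in auto)
  then have "((\<lambda>x. cdf (density lborel ?f) x * sqrt pi) has_real_derivative exp (- x\<^sup>2)) (at x)" for x
    unfolding f[symmetric] by (intro DERIV_cmult_right)
  moreover have "((\<lambda>x. cdf (density lborel ?f) x * sqrt pi) \<longlongrightarrow> 0) at_bot"
    using tendsto_mult_right[OF cdf_lim_at_bot, of "sqrt pi"] by simp
  moreover have "((\<lambda>x. cdf (density lborel ?f) x * sqrt pi) \<longlongrightarrow> sqrt pi) at_top"
    using tendsto_mult_right[OF cdf_lim_at_top_prob, of "sqrt pi"] by simp
  ultimately show ?thesis by (rule that)
qed

text \<open>For a nonnegative integrand, finite limits of the primitive at both ends already force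
  integrability. The indicator form is the one that the iterated integrals produce.\<close>

lemma has_bochner_integral_Ioi_FTC_nonneg:
  fixes f F :: "real \<Rightarrow> real"
  assumes "\<And>x. 0 < x \<Longrightarrow> (F has_real_derivative f x) (at x)"
    and "\<And>x. 0 < x \<Longrightarrow> isCont f x" and "\<And>x. 0 < x \<Longrightarrow> 0 \<le> f x"
    and "(F \<longlongrightarrow> A) (at_right 0)" and "(F \<longlongrightarrow> B) at_top"
  shows "has_bochner_integral lborel (\<lambda>x. indicator {0<..} x * f x) (B - A)"
proof -
  have e: "einterval (ereal 0) \<infinity> = {0<..}" by (auto simp: einterval_def)
  have "((F \<circ> real_of_ereal) \<longlongrightarrow> A) (at_right (ereal 0))" "((F \<circ> real_of_ereal) \<longlongrightarrow> B) (at_left \<infinity>)"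
    using assms(4,5) by (simp_all only: ereal_tendsto_simps)
  then have "set_integrable lborel (einterval (ereal 0) \<infinity>) f" "(LBINT x=ereal 0..\<infinity>. f x) = B - A"
    using assms(1-3) by (intro interval_integral_FTC_nonneg[where F = F]; auto)+
  then show ?thesis
    by (simp add: e set_integrable_def interval_lebesgue_integral_def set_lebesgue_integral_def
        has_bochner_integral_iff)
qed

text \<open>Tonelli: nonnegativity lets joint integrability be read off from the iterated integral.
  It serves the even moments.\<close>

lemma has_bochner_integral_lborel_iterated:
  fixes f :: "real \<times> real \<Rightarrow> real"
  assumes [measurable]: "f \<in> borel_measurable borel" and nn: "\<And>z. 0 \<le> f z"
    and inner: "\<And>y. has_bochner_integral lborel (\<lambda>x. f (x, y)) (h y)"
    and outer: "has_bochner_integral lborel h I"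
  shows "has_bochner_integral lborel f I"
proof -
  have hn: "0 \<le> h y" for y
    using inner[of y] nn Bochner_Integration.integral_nonneg[of lborel "\<lambda>x. f (x, y)"]
    by (simp add: has_bochner_integral_iff)
  have In: "0 \<le> I"
    using outer hn Bochner_Integration.integral_nonneg[of lborel h] by (simp add: has_bochner_integral_iff)
  have "(\<integral>\<^sup>+z. f z \<partial>lborel) = (\<integral>\<^sup>+y. (\<integral>\<^sup>+x. f (x, y) \<partial>lborel) \<partial>lborel)"
    unfolding lborel_prod[symmetric]
    by (rule lborel_pair.nn_integral_snd[symmetric]) (simp add: lborel_prod)
  also have "\<dots> = (\<integral>\<^sup>+y. h y \<partial>lborel)"
    using inner nn by (intro nn_integral_cong) (auto simp: has_bochner_integral_iff nn_integral_eq_integral)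
  also have "\<dots> = I"
    using outer hn by (auto simp: has_bochner_integral_iff nn_integral_eq_integral)
  finally show ?thesis
    using nn In by (intro has_bochner_integral_nn_integral) auto
qed

text \<open>Fubini for an integrand of varying sign, so joint integrability has to be supplied. It
  serves the odd moment, where every slice integrates to zero.\<close>

lemma has_bochner_integral_lborel_iterated_zero:
  fixes f :: "real \<times> real \<Rightarrow> real"
  assumes f: "integrable lborel f" and inner: "\<And>y. has_bochner_integral lborel (\<lambda>x. f (x, y)) 0"
  shows "has_bochner_integral lborel f 0"
proof -
  have "integral\<^sup>L lborel f = (\<integral>y. (\<integral>x. f (x, y) \<partial>lborel) \<partial>lborel)"
    using f lborel_pair.integral_snd[of "\<lambda>x y. f (x, y)"] by (simp add: lborel_prod)
  also have "\<dots> = 0"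
    using inner by (simp add: has_bochner_integral_iff)
  finally show ?thesis using f by (simp add: has_bochner_integral_iff)
qed

section \<open>Inverse Gaussian integrals\<close>

lemma inverse_gaussian_integrals:
  fixes a d :: real
  assumes a: "0 < a" and d: "0 < d"
  defines "c \<equiv> sqrt pi * exp (- 2 * sqrt (a * d))"
  shows "has_bochner_integral lborel
      (\<lambda>y. indicator {0<..} y * (sqrt y / y * exp (- (a * y + d / y)))) (c / sqrt a)" (is ?I1)
    and "has_bochner_integral lborel
      (\<lambda>y. indicator {0<..} y * (sqrt y / y\<^sup>2 * exp (- (a * y + d / y)))) (c / sqrt d)" (is ?I2)
    and "has_bochner_integral lborel
      (\<lambda>y. indicator {0<..} y * (sqrt y / y ^ 3 * exp (- (a * y + d / y))))
      ((c / sqrt d / 2 + a * (c / sqrt a)) / d)" (is ?I3)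
proof -
  \<comment> \<open>The integrands are combinations of \<open>v' exp(-v\<^sup>2)\<close> and \<open>w' exp(-w\<^sup>2)\<close> for
    \<open>v, w = k sqrt(y) -/+ r / sqrt(y)\<close>, hence have primitives built from a primitive \<open>G\<close> of \<open>exp(-x\<^sup>2)\<close>;
    \<open>w\<close> tends to \<open>+\<infinity>\<close> at both ends and so contributes nothing.\<close>
  obtain G where G: "\<And>x. (G has_real_derivative exp (- x\<^sup>2)) (at x)"
    and Gb: "(G \<longlongrightarrow> 0) at_bot" and Gt: "(G \<longlongrightarrow> sqrt pi) at_top"
    using gaussian_primitive by blast
  define k r where "k = sqrt a" and "r = sqrt d"
  have k: "0 < k" "k\<^sup>2 = a" and r: "0 < r" "r\<^sup>2 = d"
    using a d by (auto simp: k_def r_def)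
  have kr: "sqrt (a * d) = k * r" by (simp add: k_def r_def real_sqrt_mult)
  define v w where "v y = k * sqrt y - r / sqrt y" and "w y = k * sqrt y + r / sqrt y" for y
  define e where "e y = exp (- (a * y + d / y))" for y
  \<comment> \<open>The squares of \<open>v y\<close> and \<open>w y\<close> are
    \<open>a * y + d / y\<close> minus and plus \<open>2 * (k * r)\<close>; the constant factors
    compensate for these cross terms.\<close>
  have ev: "exp (- (v y)\<^sup>2) * exp (- 2 * (k * r)) = e y"
    and ew: "exp (- (w y)\<^sup>2) * exp (2 * (k * r)) = e y" if "0 < y" for y
    using that unfolding v_def w_def e_def
    by (auto simp: exp_add[symmetric] power2_sum power2_diff power_mult_distrib power_divide k r)
  have dv: "(v has_real_derivative (k + r / y) / (2 * sqrt y)) (at y)"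
    and dw: "(w has_real_derivative (k - r / y) / (2 * sqrt y)) (at y)" if "0 < y" for y
    using that unfolding v_def[abs_def] w_def[abs_def]
    by (auto intro!: derivative_eq_intros simp: field_simps power2_eq_square)
  define Gv Gw where "Gv y = G (v y) * exp (- 2 * (k * r))" and "Gw y = G (w y) * exp (2 * (k * r))" for y
  have dGv: "(Gv has_real_derivative e y * ((k + r / y) / (2 * sqrt y))) (at y)" if "0 < y" for y
    unfolding Gv_def[abs_def] ev[OF that, symmetric]
    using DERIV_cmult_right[OF DERIV_chain2[OF G dv[OF that]], of "exp (- 2 * (k * r))"]
    by (simp add: mult_ac)
  have dGw: "(Gw has_real_derivative e y * ((k - r / y) / (2 * sqrt y))) (at y)" if "0 < y" for y
    unfolding Gw_def[abs_def] ew[OF that, symmetric]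
    using DERIV_cmult_right[OF DERIV_chain2[OF G dw[OF that]], of "exp (2 * (k * r))"]
    by (simp add: mult_ac)
  have v0: "filterlim v at_bot (at_right 0)" and vt: "filterlim v at_top at_top"
    and w0: "filterlim w at_top (at_right 0)" and wt: "filterlim w at_top at_top"
    unfolding v_def[abs_def] w_def[abs_def] using k(1) r(1) by real_asymp+
  have Gv0: "(Gv \<longlongrightarrow> 0) (at_right 0)" and Gvt: "(Gv \<longlongrightarrow> c) at_top"
    unfolding Gv_def[abs_def] c_def kr
    using tendsto_mult_right[OF filterlim_compose[OF Gb v0]] tendsto_mult_right[OF filterlim_compose[OF Gt vt]]
    by fastforce+
  \<comment> \<open>\<open>m\<close> is the common limit of \<open>Gw\<close> at both ends; it
    cancels from all three integrals.\<close>
  define m where "m = sqrt pi * exp (2 * (k * r))"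
  have Gw0: "(Gw \<longlongrightarrow> m) (at_right 0)" and Gwt: "(Gw \<longlongrightarrow> m) at_top"
    unfolding Gw_def[abs_def] m_def
    by (intro tendsto_mult_right filterlim_compose[OF Gt w0] filterlim_compose[OF Gt wt])+
  \<comment> \<open>In the sum of the derivatives of \<open>Gv\<close> and \<open>Gw\<close> the
    \<open>r / y\<close> parts cancel, and in the difference the \<open>k\<close> parts; dividing by
    \<open>k\<close> or \<open>r\<close> leaves the powers -1/2 and -3/2 of \<open>y\<close> times
    \<open>e y\<close>.\<close>
  define P1 P2 where "P1 y = (Gv y + Gw y) / k" and "P2 y = (Gv y - Gw y) / r" for y
  have dP1: "(P1 has_real_derivative sqrt y / y * e y) (at y)"
    and dP2: "(P2 has_real_derivative sqrt y / y\<^sup>2 * e y) (at y)" if "0 < y" for y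
  proof -
    \<comment> \<open>Writing \<open>y\<close> as a square turns the identity between derivatives
      into one of rational functions in \<open>q\<close>.\<close>
    have "y = sqrt y * sqrt y" "0 < sqrt y" using that by simp_all
    then obtain q where q: "y = q * q" "0 < q" by blast
    show "(P1 has_real_derivative sqrt y / y * e y) (at y)"
      unfolding P1_def[abs_def]
      by (rule DERIV_cong[OF DERIV_cdivide[OF DERIV_add[OF dGv[OF that] dGw[OF that]]]])
        (use k q in \<open>simp_all add: real_sqrt_mult field_simps\<close>)
    show "(P2 has_real_derivative sqrt y / y\<^sup>2 * e y) (at y)"
      unfolding P2_def[abs_def]
      by (rule DERIV_cong[OF DERIV_cdivide[OF DERIV_diff[OF dGv[OF that] dGw[OF that]]]])
        (use r q in \<open>simp_all add: real_sqrt_mult field_simps power2_eq_square\<close>)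
  qed
  have P1: "(P1 \<longlongrightarrow> (0 + m) / k) (at_right 0)" "(P1 \<longlongrightarrow> (c + m) / k) at_top"
    unfolding P1_def[abs_def] using k by (intro tendsto_intros Gv0 Gw0 Gvt Gwt; simp)+
  have P2: "(P2 \<longlongrightarrow> (0 - m) / r) (at_right 0)" "(P2 \<longlongrightarrow> (c - m) / r) at_top"
    unfolding P2_def[abs_def] using r by (intro tendsto_intros Gv0 Gw0 Gvt Gwt; simp)+
  have ie: "isCont e y" if "0 < y" for y
    unfolding e_def[abs_def] using that by (intro continuous_intros) auto
  have en: "0 \<le> e y" for y by (simp add: e_def)
  have "has_bochner_integral lborel (\<lambda>y. indicator {0<..} y * (sqrt y / y * e y)) ((c + m) / k - (0 + m) / k)"
    by (rule has_bochner_integral_Ioi_FTC_nonneg[OF dP1 _ _ P1]) (auto intro!: continuous_intros ie simp: en)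
  then show ?I1 unfolding e_def k_def[symmetric] by (simp add: diff_divide_distrib[symmetric])
  have "has_bochner_integral lborel (\<lambda>y. indicator {0<..} y * (sqrt y / y\<^sup>2 * e y)) ((c - m) / r - (0 - m) / r)"
    by (rule has_bochner_integral_Ioi_FTC_nonneg[OF dP2 _ _ P2]) (auto intro!: continuous_intros ie simp: en)
  then show ?I2 unfolding e_def r_def[symmetric] by (simp add: diff_divide_distrib)
  \<comment> \<open>Integration by parts: the derivative of \<open>e y / sqrt y\<close> is
    \<open>d\<close> times the wanted integrand, minus half the derivative of \<open>P2\<close>,
    minus \<open>a\<close> times that of \<open>P1\<close>. Adding these back and dividing by
    \<open>d\<close> isolates it.\<close>
  define P3 where "P3 y = (e y / sqrt y + P2 y / 2 + a * P1 y) / d" for y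
  have dP3: "(P3 has_real_derivative sqrt y / y ^ 3 * e y) (at y)" if "0 < y" for y
  proof -
    have de: "(e has_real_derivative e y * (d / y\<^sup>2 - a)) (at y)"
      unfolding e_def[abs_def]
      by (rule DERIV_fun_exp, use that in \<open>auto intro!: derivative_eq_intros simp: field_simps power2_eq_square\<close>)
    have D: "(P3 has_real_derivative ((e y * (d / y\<^sup>2 - a) * sqrt y - e y * (inverse (sqrt y) / 2)) / (sqrt y * sqrt y)
        + sqrt y / y\<^sup>2 * e y / 2 + a * (sqrt y / y * e y)) / d) (at y)"
      unfolding P3_def[abs_def] using that
      by (intro DERIV_cdivide DERIV_add DERIV_cmult DERIV_divide de DERIV_real_sqrt dP1 dP2) auto
    have "y = sqrt y * sqrt y" "0 < sqrt y" using that by simp_all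
    then obtain q where q: "y = q * q" "0 < q" by blast
    show ?thesis
      by (rule DERIV_cong[OF D])
        (use q d in \<open>simp add: real_sqrt_mult field_simps power2_eq_square power3_eq_cube\<close>)
  qed
  have E: "((\<lambda>y. e y / sqrt y) \<longlongrightarrow> 0) (at_right 0)" "((\<lambda>y. e y / sqrt y) \<longlongrightarrow> 0) at_top"
    unfolding e_def using a d by real_asymp+
  have P3: "(P3 \<longlongrightarrow> (0 + (0 - m) / r / 2 + a * ((0 + m) / k)) / d) (at_right 0)"
      "(P3 \<longlongrightarrow> (0 + (c - m) / r / 2 + a * ((c + m) / k)) / d) at_top"
    unfolding P3_def[abs_def] using d by (intro tendsto_intros P1 P2 E; simp)+
  have "has_bochner_integral lborel (\<lambda>y. indicator {0<..} y * (sqrt y / y ^ 3 * e y))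
     ((0 + (c - m) / r / 2 + a * ((c + m) / k)) / d - (0 + (0 - m) / r / 2 + a * ((0 + m) / k)) / d)"
    by (rule has_bochner_integral_Ioi_FTC_nonneg[OF dP3 _ _ P3]) (auto intro!: continuous_intros ie simp: en)
  then show ?I3 unfolding e_def r_def[symmetric] k_def[symmetric]
    by (rule back_subst[of "has_bochner_integral lborel _"]) (use k r d in \<open>simp add: field_simps\<close>)
qed

section \<open>Two-by-two matrices: entries, inverse and trace\<close>

lemma sym_pos_def_entries:
  assumes "\<theta> \<in> sym_pos_def"
  shows "\<theta> $ 2 $ 1 = \<theta> $ 1 $ 2" and "0 < \<theta> $ 1 $ 1"
    and "det \<theta> = \<theta> $ 1 $ 1 * \<theta> $ 2 $ 2 - (\<theta> $ 1 $ 2)\<^sup>2"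
proof -
  show s: "\<theta> $ 2 $ 1 = \<theta> $ 1 $ 2"
    using assms by (auto simp: sym_pos_def_def transpose_def vec_eq_iff)
  show "det \<theta> = \<theta> $ 1 $ 1 * \<theta> $ 2 $ 2 - (\<theta> $ 1 $ 2)\<^sup>2"
    by (simp add: det_2 s power2_eq_square)
  have "vector [1, 0] \<noteq> (0 :: real^2)"
    by (simp add: vec_eq_iff forall_2)
  then have "0 < vector [1, 0] \<bullet> (\<theta> *v vector [1, 0])"
    using assms unfolding sym_pos_def_def by blast
  then show "0 < \<theta> $ 1 $ 1"
    by (simp add: inner_vec_def sum_2 matrix_vector_mult_def)
qed

text \<open>\<open>matrix_inv\<close> is defined by choice. A right inverse of a square matrix is
  two-sided, and two-sided inverses are unique, so the choice must be \<open>B\<close>.\<close>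

lemma matrix_inv_eqI:
  fixes A B :: "real^'n^'n"
  assumes "A ** B = mat 1"
  shows "matrix_inv A = B"
proof -
  have BA: "B ** A = mat 1" using assms by (simp add: matrix_left_right_inverse)
  have "A ** matrix_inv A = mat 1 \<and> matrix_inv A ** A = mat 1"
    unfolding matrix_inv_def by (rule someI[of _ B]) (simp add: assms BA)
  then show ?thesis
    by (metis BA matrix_mul_assoc matrix_mul_lid matrix_mul_rid)
qed

lemma trace_mult_matrix_inv_2:
  fixes A B :: "real^2^2"
  assumes "det A \<noteq> 0"
  shows "trace (B ** matrix_inv A) =
    (B$1$1 * A$2$2 - B$1$2 * A$2$1 - B$2$1 * A$1$2 + B$2$2 * A$1$1) / det A"
proof -
  \<comment> \<open>The adjugate of \<open>A\<close> divided by its determinant.\<close>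
  define C :: "real^2^2" where
    "C = vector [vector [A$2$2 / det A, - A$1$2 / det A], vector [- A$2$1 / det A, A$1$1 / det A]]"
  have "A ** C = mat 1"
    using assms by (simp add: C_def vec_eq_iff forall_2 matrix_matrix_mult_def sum_2 mat_def
        det_2 divide_simps)
  then have "matrix_inv A = C" by (rule matrix_inv_eqI)
  then show ?thesis
    by (simp add: C_def trace_def sum_2 matrix_matrix_mult_def diff_divide_distrib add_divide_distrib)
qed

section \<open>Factorization and moments of the Poincare density\<close>

text \<open>The normal factor carries the normalization \<open>sqrt (a / (pi * y))\<close>. Dividing
  it out of the original prefactor leaves \<open>sqrt y / y\<^sup>2\<close> and turns
  \<open>1 / pi\<close> into \<open>1 / sqrt (pi * a)\<close>.\<close>

lemma poincare_density_factor:
  assumes "\<theta> \<in> sym_pos_def" and y: "0 < y"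
  defines "a \<equiv> \<theta> $ 1 $ 1" and "b \<equiv> \<theta> $ 1 $ 2" and "D \<equiv> det \<theta>"
  shows "poincare_density \<theta> (x, y) = normal_density (- b / a) (sqrt (y / (2 * a))) x *
    (sqrt D * exp (2 * sqrt D) / sqrt (pi * a) * (sqrt y / y\<^sup>2 * exp (- (a * y + D / a / y))))"
proof -
  have a: "0 < a" and D: "D = a * \<theta> $ 2 $ 2 - b\<^sup>2"
    using sym_pos_def_entries[OF assms(1)] by (simp_all add: a_def b_def D_def)
  \<comment> \<open>After completing the square the constant term is
    \<open>\<theta> $ 2 $ 2 - b\<^sup>2 / a\<close>, which is \<open>D / a\<close>.\<close>
  have e: "(a * (x\<^sup>2 + y\<^sup>2) + 2 * b * x + \<theta> $ 2 $ 2) / y =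
      (x - (- b / a))\<^sup>2 / (2 * (y / (2 * a))) + (a * y + D / a / y)"
    using a y unfolding D by (simp add: field_simps power2_eq_square)
  have q: "sqrt a / (sqrt pi * sqrt y) = 1 / sqrt (pi * y / a)"
    by (simp add: real_sqrt_mult real_sqrt_divide)
  have "(sqrt (y / (2 * a)))\<^sup>2 = y / (2 * a)" using a y by simp
  then have n: "normal_density (- b / a) (sqrt (y / (2 * a))) x =
      sqrt a / (sqrt pi * sqrt y) * exp (- ((x - (- b / a))\<^sup>2 / (2 * (y / (2 * a)))))"
    using a y by (simp only: normal_density_def q) simp
  show ?thesis
    unfolding n poincare_density_def case_prod_conv a_def[symmetric] b_def[symmetric] D_def[symmetric] e
    using a y by (simp add: exp_add[symmetric] real_sqrt_mult field_simps)
qed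

text \<open>For fixed \<open>y\<close> the integral over \<open>x\<close> is an even central moment
  of a normal law of variance \<open>y / (2 * a)\<close>, which supplies the factorials and the
  power of \<open>y / (4 * a)\<close>. Only a one-dimensional integral in \<open>y\<close>
  remains.\<close>

lemma poincare_even_moment:
  assumes \<theta>: "\<theta> \<in> sym_pos_def"
    and \<phi>: "\<phi> \<in> borel_measurable borel" "\<And>y. 0 < y \<Longrightarrow> 0 \<le> \<phi> y"
  defines "a \<equiv> \<theta> $ 1 $ 1" and "b \<equiv> \<theta> $ 1 $ 2" and "D \<equiv> det \<theta>"
  assumes I: "has_bochner_integral lborel (\<lambda>y. indicator {0<..} y *
      (sqrt y / y\<^sup>2 * exp (- (a * y + D / a / y)) * (\<phi> y * (fact (2 * k) / fact k * (y / (4 * a)) ^ k)))) I"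
  shows "has_bochner_integral lborel (\<lambda>(x, y). indicator upper_half_plane (x, y) *
      (poincare_density \<theta> (x, y) * ((x + b / a) ^ (2 * k) * \<phi> y)))
      (sqrt D * exp (2 * sqrt D) / sqrt (pi * a) * I)"
proof (rule has_bochner_integral_lborel_iterated)
  have a: "0 < a" using sym_pos_def_entries[OF \<theta>] by (simp add: a_def)
  have [measurable]: "\<phi> \<in> borel_measurable borel" by fact
  have [measurable]: "Measurable.pred (borel \<Otimes>\<^sub>M borel) (\<lambda>z. z \<in> upper_half_plane)"
    "poincare_density \<theta> \<in> borel_measurable (borel \<Otimes>\<^sub>M borel)"
    by (simp_all add: borel_prod)
  show "(\<lambda>(x, y). indicator upper_half_plane (x, y) *
      (poincare_density \<theta> (x, y) * ((x + b / a) ^ (2 * k) * \<phi> y))) \<in> borel_measurable borel"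
    unfolding borel_prod[symmetric] by measurable
  show "0 \<le> (case z of (x, y) \<Rightarrow> indicator upper_half_plane (x, y) *
      (poincare_density \<theta> (x, y) * ((x + b / a) ^ (2 * k) * \<phi> y)))" for z
    using poincare_density_pos[OF \<theta>, of z] \<phi>(2)
    by (cases z) (auto simp: indicator_def upper_half_plane_def less_imp_le power_mult)
  let ?C = "sqrt D * exp (2 * sqrt D) / sqrt (pi * a)"
  let ?h = "\<lambda>y. ?C * (indicator {0<..} y * (sqrt y / y\<^sup>2 * exp (- (a * y + D / a / y)) *
      (\<phi> y * (fact (2 * k) / fact k * (y / (4 * a)) ^ k))))"
  show "has_bochner_integral lborel ?h (?C * I)"
    by (rule has_bochner_integral_mult_right) (use I in simp)
  show "has_bochner_integral lborel (\<lambda>x. case (x, y) of (x, y) \<Rightarrow> indicator upper_half_plane (x, y) *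
      (poincare_density \<theta> (x, y) * ((x + b / a) ^ (2 * k) * \<phi> y))) (?h y)" for y
  proof (cases "0 < y")
    case False
    then show ?thesis by (simp add: upper_half_plane_def has_bochner_integral_zero)
  next
    case True
    let ?g = "?C * (sqrt y / y\<^sup>2 * exp (- (a * y + D / a / y)))"
    let ?N = "normal_density (- b / a) (sqrt (y / (2 * a)))"
    have "has_bochner_integral lborel (\<lambda>x. ?g * \<phi> y * (?N x * (x - (- b / a)) ^ (2 * k)))
      (?g * \<phi> y * (fact (2 * k) / ((2 / (sqrt (y / (2 * a)))\<^sup>2) ^ k * fact k)))"
      by (rule has_bochner_integral_mult_right, rule normal_moment_even) (use a True in simp)
    also have "(\<lambda>x. ?g * \<phi> y * (?N x * (x - (- b / a)) ^ (2 * k))) =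
      (\<lambda>x. case (x, y) of (x, y) \<Rightarrow> indicator upper_half_plane (x, y) *
      (poincare_density \<theta> (x, y) * ((x + b / a) ^ (2 * k) * \<phi> y)))"
      using True by (simp add: fun_eq_iff poincare_density_factor[OF \<theta> True] upper_half_plane_def
        a_def b_def D_def mult_ac)
    also have "?g * \<phi> y * (fact (2 * k) / ((2 / (sqrt (y / (2 * a)))\<^sup>2) ^ k * fact k)) = ?h y"
      using True a by (simp add: power_divide power_mult_distrib mult_ac)
    finally show ?thesis .
  qed
qed

text \<open>These are the expectations needed for the logarithm of the density ratio.
  \<open>E T t\<close> asserts both that \<open>T\<close> is integrable against the density and that
  its mean is \<open>t\<close>.\<close>

lemma poincare_moments:
  assumes \<theta>: "\<theta> \<in> sym_pos_def"
  defines "a \<equiv> \<theta> $ 1 $ 1" and "b \<equiv> \<theta> $ 1 $ 2" and "D \<equiv> det \<theta>"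
    and "E \<equiv> \<lambda>T. has_bochner_integral lborel
      (\<lambda>z. indicator upper_half_plane z * (poincare_density \<theta> z * T z))"
  shows "E (\<lambda>_. 1) 1"
    and "E (\<lambda>(x, y). 1 / y) ((1 / 2 + sqrt D) * a / D)"
    and "E (\<lambda>(x, y). y) (sqrt D / a)"
    and "E (\<lambda>(x, y). (x + b / a)\<^sup>2 / y) (1 / (2 * a))"
    and "E (\<lambda>(x, y). (x + b / a) / y) 0"
proof -
  have a: "0 < a" using sym_pos_def_entries[OF \<theta>] by (simp add: a_def)
  have D: "0 < D" using sym_pos_def_det_pos[OF \<theta>] by (simp add: D_def)
  define s ra where "s = sqrt D" and "ra = sqrt a"
  have s: "0 < s" "D = s * s" and ra: "0 < ra" "a = ra * ra"
    using a D by (auto simp: s_def ra_def)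
  have sD: "sqrt D = s" "sqrt (a * (D / a)) = s" "sqrt (D / a) = s / ra" "sqrt a = ra"
    "sqrt (pi * a) = sqrt pi * ra"
    using a by (simp_all add: s_def ra_def real_sqrt_mult real_sqrt_divide)
  define C where "C = s * exp (2 * s) / (sqrt pi * ra)"
  define c where "c = sqrt pi * exp (- 2 * s)"
  \<comment> \<open>With \<open>d = D / a\<close> the product \<open>a * d\<close> is
    \<open>D\<close>, so the exponential in the inverse Gaussian constant \<open>c\<close> cancels
    the one in the prefactor \<open>C\<close>.\<close>
  have Cc: "C * c = s / ra"
    by (simp add: C_def c_def exp_minus field_simps)
  have d: "0 < D / a" using a D by simp
  note J = inverse_gaussian_integrals[OF a d, unfolded sD, folded c_def]
  note M = poincare_even_moment[OF \<theta>, folded a_def b_def D_def, unfolded sD, folded C_def]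
  \<comment> \<open>Matches an integrand \<open>\<psi>\<close> of the shape found in
    \<open>J\<close> with the weighted one in \<open>M\<close>; agreement on positive
    \<open>y\<close> suffices because of the indicators.\<close>
  have even: "E (\<lambda>(x, y). T x y) (C * I)"
    if "\<phi> \<in> borel_measurable borel" "\<And>y. 0 < y \<Longrightarrow> 0 \<le> \<phi> y"
      and T: "\<And>x y. 0 < y \<Longrightarrow> T x y = (x + b / a) ^ (2 * k) * \<phi> y"
      and I: "has_bochner_integral lborel (\<lambda>y. indicator {0<..} y * \<psi> y) I"
      and \<psi>: "\<And>y. 0 < y \<Longrightarrow> \<psi> y =
        sqrt y / y\<^sup>2 * exp (- (a * y + D / a / y)) * (\<phi> y * (fact (2 * k) / fact k * (y / (4 * a)) ^ k))"
    for T :: "real \<Rightarrow> real \<Rightarrow> real" and \<phi> \<psi> I k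
  proof -
    have "(\<lambda>y. indicator {0<..} y * \<psi> y) = (\<lambda>y. indicator {0<..} y * (sqrt y / y\<^sup>2 *
        exp (- (a * y + D / a / y)) * (\<phi> y * (fact (2 * k) / fact k * (y / (4 * a)) ^ k))))"
      using \<psi> by (auto simp: fun_eq_iff indicator_def)
    from M[OF that(1,2) I[unfolded this]] show ?thesis
      unfolding E_def
      by (rule has_bochner_integral_cong[THEN iffD1, rotated -1])
        (auto simp: indicator_def upper_half_plane_def T)
  qed
  have m0: "E (\<lambda>(x, y). 1) (C * (c / (s / ra)))"
    by (rule even[where k = 0, OF _ _ _ J(2)]) auto
  have "C * (c / (s / ra)) = 1"
    unfolding times_divide_eq_right Cc using s(1) ra(1) by simp
  from m0[unfolded this] show "E (\<lambda>_. 1) 1"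
    by (simp add: case_prod_unfold)
  have "E (\<lambda>(x, y). y) (C * (c / ra))"
    by (rule even[where k = 0 and \<phi> = "\<lambda>y. y", OF _ _ _ J(1)]) (auto simp: power2_eq_square)
  then show "E (\<lambda>(x, y). y) (sqrt D / a)"
    using Cc s ra by (simp add: sD)
  have "E (\<lambda>(x, y). 1 / y) (C * ((c / (s / ra) / 2 + a * (c / ra)) / (D / a)))"
    by (rule even[where k = 0 and \<phi> = "\<lambda>y. 1 / y", OF _ _ _ J(3)])
      (auto simp: power2_eq_square power3_eq_cube)
  also have "C * ((c / (s / ra) / 2 + a * (c / ra)) / (D / a)) = C * c * (ra / s / 2 + ra) * a / D"
    using s ra a D by (simp add: field_simps)
  also have "\<dots> = (1 / 2 + sqrt D) * a / D"
    unfolding Cc sD using s(1) ra(1) by (simp add: distrib_left)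
  finally show m1: "E (\<lambda>(x, y). 1 / y) ((1 / 2 + sqrt D) * a / D)" .
  \<comment> \<open>The variance \<open>y / (2 * a)\<close> cancels the weight \<open>1 / y\<close>,
    so this is the normalization integral \<open>J(2)\<close> scaled by
    \<open>1 / (2 * a)\<close>.\<close>
  have "E (\<lambda>(x, y). (x + b / a)\<^sup>2 / y) (C * (c / (s / ra) * (1 / (2 * a))))"
    by (rule even[where k = 1 and \<phi> = "\<lambda>y. 1 / y",
          OF _ _ _ has_bochner_integral_mult_left[OF J(2), of "1 / (2 * a)", unfolded mult.assoc]])
      (use a in \<open>auto simp: field_simps power2_eq_square\<close>)
  then show m2: "E (\<lambda>(x, y). (x + b / a)\<^sup>2 / y) (1 / (2 * a))"
    using Cc s ra by (simp add: mult_ac)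
  show "E (\<lambda>(x, y). (x + b / a) / y) 0"
    unfolding E_def
  proof (rule has_bochner_integral_lborel_iterated_zero)
    have [measurable]: "Measurable.pred (borel \<Otimes>\<^sub>M borel) (\<lambda>z. z \<in> upper_half_plane)"
      "poincare_density \<theta> \<in> borel_measurable (borel \<Otimes>\<^sub>M borel)"
      by (simp_all add: borel_prod)
    have "(\<lambda>z. indicator upper_half_plane z * (poincare_density \<theta> z * (case z of (x, y) \<Rightarrow> (x + b / a) / y)))
        \<in> borel_measurable (borel \<Otimes>\<^sub>M borel)"
      by measurable
    moreover have "integrable lborel (\<lambda>z. indicator upper_half_plane z *
          (poincare_density \<theta> z * (case z of (x, y) \<Rightarrow> 1 / y)) +
        indicator upper_half_plane z *
          (poincare_density \<theta> z * (case z of (x, y) \<Rightarrow> (x + b / a)\<^sup>2 / y)))"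
      using m1 m2 by (auto simp: E_def has_bochner_integral_iff)
    \<comment> \<open>This bound with \<open>u = x + b / a\<close> dominates the odd integrand by
      the sum of those in \<open>m1\<close> and \<open>m2\<close>, giving the integrability that
      Fubini requires.\<close>
    moreover have "\<bar>u\<bar> \<le> 1 + u\<^sup>2" for u :: real
      using zero_le_power2[of "\<bar>u\<bar> - 1"] by (simp add: power2_diff)
    then have "q * \<bar>u\<bar> / y \<le> q / y + q * u\<^sup>2 / y" if "0 < y" "0 < q" for q u y :: real
      using that mult_left_mono[of "\<bar>u\<bar>" "1 + u\<^sup>2" q]
      by (simp add: add_divide_distrib[symmetric] divide_right_mono distrib_left)
    then have "norm (indicator upper_half_plane z *
          (poincare_density \<theta> z * (case z of (x, y) \<Rightarrow> (x + b / a) / y)))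
      \<le> norm (indicator upper_half_plane z *
          (poincare_density \<theta> z * (case z of (x, y) \<Rightarrow> 1 / y)) +
        indicator upper_half_plane z *
          (poincare_density \<theta> z * (case z of (x, y) \<Rightarrow> (x + b / a)\<^sup>2 / y)))" for z
      using poincare_density_pos[OF \<theta>, of z]
      by (cases z) (auto simp: indicator_def upper_half_plane_def abs_mult
        intro!: order_trans[OF _ abs_ge_self])
    ultimately show "integrable lborel (\<lambda>z. indicator upper_half_plane z *
          (poincare_density \<theta> z * (case z of (x, y) \<Rightarrow> (x + b / a) / y)))"
      by (elim Bochner_Integration.integrable_bound[OF _ _ AE_I2]) (simp_all add: borel_prod)
    show "has_bochner_integral lborel (\<lambda>x. indicator upper_half_plane (x, y) *
        (poincare_density \<theta> (x, y) * (case (x, y) of (x, y) \<Rightarrow> (x + b / a) / y))) 0" for y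
    proof (cases "0 < y")
      case False
      then show ?thesis by (simp add: upper_half_plane_def has_bochner_integral_zero)
    next
      case True
      let ?g = "C * (sqrt y / y\<^sup>2 * exp (- (a * y + D / a / y))) / y"
      let ?N = "normal_density (- b / a) (sqrt (y / (2 * a)))"
      have "has_bochner_integral lborel (\<lambda>x. ?g * (?N x * (x - (- b / a)) ^ (2 * 0 + 1))) (?g * 0)"
        by (rule has_bochner_integral_mult_right, rule normal_moment_odd) (use a True in simp)
      then show ?thesis
        using True by (simp add: poincare_density_factor[OF \<theta> True] upper_half_plane_def
          a_def[symmetric] b_def[symmetric] D_def[symmetric] sD C_def mult_ac)
    qed
  qed
qed

section \<open>The log-density ratio and the divergence formula\<close>

text \<open>The factors \<open>1 / pi\<close> and \<open>1 / y\<^sup>2\<close> are common to both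
  densities and cancel, leaving the normalizing constants and the difference of the two
  exponents.\<close>

lemma ln_poincare_density_ratio:
  assumes \<theta>: "\<theta> \<in> sym_pos_def" and \<theta>': "\<theta>' \<in> sym_pos_def" and y: "0 < y"
  shows "ln (poincare_density \<theta> (x, y) / poincare_density \<theta>' (x, y)) =
    1 / 2 * ln (det \<theta> / det \<theta>') + 2 * (sqrt (det \<theta>) - sqrt (det \<theta>')) -
    ((\<theta>$1$1 - \<theta>'$1$1) * (x\<^sup>2 + y\<^sup>2) + 2 * (\<theta>$1$2 - \<theta>'$1$2) * x + (\<theta>$2$2 - \<theta>'$2$2)) / y"
proof -
  have D: "0 < det \<theta>" "0 < det \<theta>'" using \<theta> \<theta>' by (auto intro: sym_pos_def_det_pos)
  have ln: "ln (poincare_density t (x, y)) = 1 / 2 * ln (det t) + 2 * sqrt (det t) - ln pi -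
      (t$1$1 * (x\<^sup>2 + y\<^sup>2) + 2 * t$1$2 * x + t$2$2) / y - 2 * ln y"
    if "0 < det t" for t
    using that y by (simp add: poincare_density_def ln_mult ln_div ln_sqrt ln_realpow)
  have "0 < poincare_density \<theta> (x, y)" "0 < poincare_density \<theta>' (x, y)"
    using \<theta> \<theta>' y by (auto intro: poincare_density_pos simp: upper_half_plane_def)
  then show ?thesis
    using D by (simp add: ln_div ln diff_divide_distrib add_divide_distrib algebra_simps)
qed

text \<open>The Bochner integral of a non-integrable function is 0 by convention; the integrability
  conjunct ensures that the formula describes a genuine integral.\<close>

theorem proposition4:
  fixes \<theta> \<theta>' :: "real^2^2"
  assumes "\<theta> \<in> sym_pos_def" and "\<theta>' \<in> sym_pos_def"
  shows "integrable (poincare_distribution \<theta>)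
           (entropy_density (exp 1) (poincare_distribution \<theta>') (poincare_distribution \<theta>))
       \<and> KL_div (poincare_distribution \<theta>) (poincare_distribution \<theta>') =
           1 / 2 * ln (det \<theta> / det \<theta>')
           + 2 * (sqrt (det \<theta>) - sqrt (det \<theta>'))
           + (1 / 2 + sqrt (det \<theta>)) * (trace (\<theta>' ** matrix_inv \<theta>) - 2)"
proof -
  define a b c where "a = \<theta>$1$1" and "b = \<theta>$1$2" and "c = \<theta>$2$2"
  define A B C where "A = a - \<theta>'$1$1" and "B = b - \<theta>'$1$2" and "C = c - \<theta>'$2$2"
  define D where "D = det \<theta>"
  have a: "0 < a" and D_eq: "D = a * c - b\<^sup>2"
    using sym_pos_def_entries[OF assms(1)] by (simp_all add: a_def b_def c_def D_def)
  have D: "0 < D" using sym_pos_def_det_pos[OF assms(1)] by (simp add: D_def)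
  define \<alpha> where "\<alpha> = 1 / 2 * ln (det \<theta> / det \<theta>') + 2 * (sqrt (det \<theta>) - sqrt (det \<theta>'))"
  \<comment> \<open>The value of \<open>A * x\<^sup>2 + 2 * B * x + C\<close> at
    \<open>x = - b / a\<close>, that is, its constant term when expanded about the conditional mean
    of \<open>x\<close>.\<close>
  define \<kappa> where "\<kappa> = A * b\<^sup>2 / a\<^sup>2 - 2 * B * b / a + C"
  define p where "p z = indicator upper_half_plane z * poincare_density \<theta> z" for z :: "real \<times> real"
  note m = poincare_moments[OF assms(1), folded a_def b_def D_def mult.assoc, folded p_def]
  let ?T = "\<lambda>(x, y). \<alpha> - A * y - A * ((x + b / a)\<^sup>2 / y) - 2 * (B - A * b / a) * ((x + b / a) / y) - \<kappa> * (1 / y)"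
  have ln: "indicator upper_half_plane z *
      (poincare_density \<theta> z * ln (poincare_density \<theta> z / poincare_density \<theta>' z)) = p z * ?T z" for z
  proof (cases z)
    case (Pair x y)
    have "(A * (x\<^sup>2 + y\<^sup>2) + 2 * B * x + C) / y =
        A * y + A * ((x + b / a)\<^sup>2 / y) + 2 * (B - A * b / a) * ((x + b / a) / y) + \<kappa> * (1 / y)" if "0 < y"
      using that a unfolding \<kappa>_def by (simp add: field_simps power2_eq_square)
    then show ?thesis
      using ln_poincare_density_ratio[OF assms, of y x]
      by (auto simp: Pair p_def indicator_def upper_half_plane_def \<alpha>_def
          a_def[symmetric] b_def[symmetric] c_def[symmetric] A_def[symmetric] B_def[symmetric] C_def[symmetric])
  qed
  have "has_bochner_integral lborel
      (\<lambda>z. \<alpha> * (p z * 1) - A * (p z * (case z of (x, y) \<Rightarrow> y))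
        - A * (p z * (case z of (x, y) \<Rightarrow> (x + b / a)\<^sup>2 / y))
        - 2 * (B - A * b / a) * (p z * (case z of (x, y) \<Rightarrow> (x + b / a) / y))
        - \<kappa> * (p z * (case z of (x, y) \<Rightarrow> 1 / y)))
      (\<alpha> * 1 - A * (sqrt D / a) - A * (1 / (2 * a)) - 2 * (B - A * b / a) * 0
        - \<kappa> * ((1 / 2 + sqrt D) * a / D))"
    by (intro has_bochner_integral_diff has_bochner_integral_mult_right m)
  also have "(\<lambda>z. \<alpha> * (p z * 1) - A * (p z * (case z of (x, y) \<Rightarrow> y))
        - A * (p z * (case z of (x, y) \<Rightarrow> (x + b / a)\<^sup>2 / y))
        - 2 * (B - A * b / a) * (p z * (case z of (x, y) \<Rightarrow> (x + b / a) / y))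
        - \<kappa> * (p z * (case z of (x, y) \<Rightarrow> 1 / y))) = (\<lambda>z. p z * ?T z)"
    by (auto simp: fun_eq_iff algebra_simps)
  \<comment> \<open>The means of \<open>y\<close> and of \<open>(x + b / a)\<^sup>2 / y\<close> add
    up to \<open>(1 / 2 + sqrt D) / a\<close>, so the factor \<open>1 / 2 + sqrt D\<close> comes out
    of every nonconstant term.\<close>
  also have "\<alpha> * 1 - A * (sqrt D / a) - A * (1 / (2 * a)) - 2 * (B - A * b / a) * 0
        - \<kappa> * ((1 / 2 + sqrt D) * a / D) = \<alpha> - (1 / 2 + sqrt D) * (A / a + \<kappa> * a / D)"
    using a D by (simp add: field_simps)
  also have "A / a + \<kappa> * a / D = (A * c - 2 * B * b + C * a) / D"
  proof -
    \<comment> \<open>The terms in \<open>A * b\<^sup>2\<close> from \<open>D\<close> and from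
      \<open>\<kappa>\<close> cancel.\<close>
    have "A * D + \<kappa> * a * a = (A * c - 2 * B * b + C * a) * a"
      using a unfolding \<kappa>_def D_eq by (simp add: field_simps power2_eq_square)
    moreover have "A / a + \<kappa> * a / D = (A * D + \<kappa> * a * a) / (D * a)"
      using a D by (simp add: add_frac_eq mult_ac)
    ultimately show ?thesis using a by simp
  qed
  \<comment> \<open>The left side is the trace of the difference of the two matrices times the
    inverse of \<open>\<theta>\<close>; the 2 is the trace of the identity matrix.\<close>
  also have "\<dots> = 2 - trace (\<theta>' ** matrix_inv \<theta>)"
  proof -
    have "trace (\<theta>' ** matrix_inv \<theta>) = (\<theta>'$1$1 * c - 2 * \<theta>'$1$2 * b + \<theta>'$2$2 * a) / D"
      using trace_mult_matrix_inv_2[of \<theta> \<theta>'] D sym_pos_def_entries(1)[OF assms(1)]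
        sym_pos_def_entries(1)[OF assms(2)] by (simp add: a_def b_def c_def D_def algebra_simps)
    moreover have "A * c - 2 * B * b + C * a =
        2 * D - (\<theta>'$1$1 * c - 2 * \<theta>'$1$2 * b + \<theta>'$2$2 * a)"
      unfolding D_eq A_def B_def C_def by (simp add: algebra_simps power2_eq_square)
    ultimately show ?thesis using D by (simp add: diff_divide_distrib)
  qed
  finally have I: "has_bochner_integral lborel (\<lambda>z. p z * ?T z)
    (\<alpha> - (1 / 2 + sqrt D) * (2 - trace (\<theta>' ** matrix_inv \<theta>)))" .
  show ?thesis
    unfolding integrable_entropy_density_poincare_iff[OF assms] KL_div_poincare_eq[OF assms]
      set_integrable_def set_lebesgue_integral_def real_scaleR_def ln
    using I by (simp add: has_bochner_integral_iff \<alpha>_def D_def right_diff_distrib)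
qed

end
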